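(* There exist absolute constants $c>0$ and $\varepsilon_0>0$ such that for every integer $m\ge 2$, every $0<\varepsilon<\varepsilon_0$, and every sufficiently large $n$ (depending on $m$ and $\varepsilon$), every one-sided non-adaptive $\varepsilon$-test for $\mathcal{S}_m$ over $\{0,1\}^n$ in the Huge Object model makes at least $c\,\varepsilon^{-1} m\log \varepsilon^{-1}$ queries (in the worst case).
   Context: Huge Object model: the input is an unknown distribution $P$ over $\{0,1\}^n$. An algorithm may repeatedly draw independent samples $x\sim P$ and may only query individual bits $x_j$ of drawn samples; its query complexity is the total number of bit queries. It is non-adaptive if all sampling and querying decisions are fixed in advance before any answer is received. $d_H(u,v)=\frac1n|\{i:u_i\ne v_i\}|$; for distributions $P,Q$ over $\{0,1\}^n$, $d(P,Q)=\min_T\mathbb{E}_{(u,v)\sim T}[d_H(u,v)]$ over couplings $T$ of $P,Q$. $\mathcal{S}_m$ is the set of distributions supported on at most $m$ elements; $P$ is $\varepsilon$-far from $\mathcal{S}_m$ if $\min_{Q\in\mathcal{S}_m}d(P,Q)>\varepsilon$. A one-sided $\varepsilon$-test for $\mathcal{S}_m$ accepts every $P\in\mathcal{S}_m$ with probability $1$ and rejects every $P$ that is $\varepsilon$-far from $\mathcal{S}_m$ with probability greater than $2/3$. *)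

theory Defs
  imports "HOL-Probability.Probability"
begin

definition cube :: "nat \<Rightarrow> bool list set" where
  "cube n = {x. length x = n}"

definition hamming_dist :: "nat \<Rightarrow> bool list \<Rightarrow> bool list \<Rightarrow> real" where
  "hamming_dist n u v = real (card {i. i < n \<and> u ! i \<noteq> v ! i}) / real n"

definition couplings :: "'a pmf \<Rightarrow> 'a pmf \<Rightarrow> ('a \<times> 'a) pmf set" where
  "couplings P Q = {T. map_pmf fst T = P \<and> map_pmf snd T = Q}"

text \<open>For distributions on the cube both infima below (here and in the definition of farness)
  are attained, so they are minima.\<close>

definition emd :: "nat \<Rightarrow> bool list pmf \<Rightarrow> bool list pmf \<Rightarrow> real" where
  "emd n P Q =
     (INF T \<in> couplings P Q. measure_pmf.expectation T (\<lambda>(u, v). hamming_dist n u v))"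

definition small_support :: "nat \<Rightarrow> nat \<Rightarrow> bool list pmf set" where
  "small_support n m = {P. set_pmf P \<subseteq> cube n \<and> card (set_pmf P) \<le> m}"

definition far_from :: "nat \<Rightarrow> real \<Rightarrow> bool list pmf \<Rightarrow> bool list pmf set \<Rightarrow> bool" where
  "far_from n \<epsilon> P S \<longleftrightarrow> (INF Q \<in> S. emd n P Q) > \<epsilon>"

text \<open>A fixing of the internal coins of a non-adaptive algorithm: the number of samples to draw,
  the list of queries, where \<open>(i, j)\<close> asks for bit \<open>j\<close> of the \<open>i\<close>-th sample, and the decision
  (\<open>True\<close> for accept) as a function of the list of answers. A randomized non-adaptive algorithm is
  a distribution over these. Discrete distributions lose no generality: for each of the countably
  many pairs of a sample number and a query list there are only finitely many possible answers,
  hence only finitely many decision rules that differ on them.\<close>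

datatype plan = Plan
  (num_samples: nat) (queries: "(nat \<times> nat) list") (decide: "bool list \<Rightarrow> bool")

definition nonadaptive_alg :: "nat \<Rightarrow> plan pmf \<Rightarrow> bool" where
  "nonadaptive_alg n A \<longleftrightarrow>
     (\<forall>a \<in> set_pmf A. \<forall>(i, j) \<in> set (queries a). i < num_samples a \<and> j < n)"

definition verdict :: "plan pmf \<Rightarrow> bool list pmf \<Rightarrow> bool pmf" where
  "verdict A P =
     bind_pmf A (\<lambda>a.
       map_pmf (\<lambda>X. decide a (map (\<lambda>(i, j). X ! i ! j) (queries a)))
         (replicate_pmf (num_samples a) P))"

definition one_sided_test :: "nat \<Rightarrow> nat \<Rightarrow> real \<Rightarrow> plan pmf \<Rightarrow> bool" where
  "one_sided_test n m \<epsilon> A \<longleftrightarrow>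
     (\<forall>P \<in> small_support n m. pmf (verdict A P) True = 1) \<and>
     (\<forall>P. set_pmf P \<subseteq> cube n \<and> far_from n \<epsilon> P (small_support n m) \<longrightarrow>
        pmf (verdict A P) False > 2 / 3)"

text \<open>Worst case over the internal coins; the number of queries of a non-adaptive algorithm does
  not depend on the input. The value is \<open>\<infinity>\<close> if the number of queries is unbounded.\<close>

definition query_complexity :: "plan pmf \<Rightarrow> ereal" where
  "query_complexity A = (SUP a \<in> set_pmf A. ereal (real (length (queries a))))"

end

theory Submission
  imports Defs
begin

text \<open>Fix a random set \<open>S\<close> of positions. The strings of the hard input are \<open>0\<close> and the indicator
  of \<open>S\<close>, which are frequent, and \<open>2 m\<close> rare strings, each supported on a different half of \<open>S\<close>.
  A rare sample can be told apart from both frequent strings only if it is queried at two positions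
  of \<open>S\<close>, and a one-sided test may reject only after telling apart more than \<open>m\<close> strings, so it
  needs about \<open>m\<close> rare samples with two such queries. At scale \<open>k\<close>, where \<open>S\<close> has density \<open>1 / 2 ^ k\<close>
  and the rare strings have total mass of order \<open>2 ^ k \<epsilon>\<close>, the input is \<open>\<epsilon>\<close>-far, and a sample with
  \<open>q\<close> queries contributes at most order \<open>2 ^ k \<epsilon> min 1 ((q / 2 ^ k)\<^sup>2)\<close> to the expected number of
  those samples. Because of the square, the sum of this over all \<open>k\<close> is only \<open>O(\<epsilon> q)\<close>. The same plan
  has to work at all \<open>log (1 / \<epsilon>)\<close> scales, so \<open>\<epsilon>\<close> times the total number of queries is at least of
  order \<open>m log (1 / \<epsilon>)\<close>.\<close>

section \<open>Codewords that are pairwise far apart\<close>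

text \<open>The map \<open>\<phi>\<close> keeps \<open>f\<close> and negates \<open>g\<close>, so it
  sends agreements injectively to disagreements.\<close>

lemma card_disagree_ge:
  fixes f g :: "nat \<Rightarrow> bool"
  assumes "\<And>r. r < s \<Longrightarrow> \<phi> r < s" and "inj_on \<phi> {..<s}"
    and "\<And>r. r < s \<Longrightarrow> f (\<phi> r) = f r" and "\<And>r. r < s \<Longrightarrow> g (\<phi> r) \<noteq> g r"
  shows "s \<le> 2 * card {r. r < s \<and> f r \<noteq> g r}"
proof -
  have "card {r. r < s \<and> f r = g r} \<le> card {r. r < s \<and> f r \<noteq> g r}"
    using assms by (intro card_inj_on_le[of \<phi>]) (auto simp: inj_on_def)
  moreover have "card ({r. r < s \<and> f r = g r} \<union> {r. r < s \<and> f r \<noteq> g r})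
      = card {r. r < s \<and> f r = g r} + card {r. r < s \<and> f r \<noteq> g r}"
    by (rule card_Un_disjoint) auto
  moreover have "{r. r < s \<and> f r = g r} \<union> {r. r < s \<and> f r \<noteq> g r} = {..<s}"
    by auto
  ultimately show ?thesis by simp
qed

text \<open>Labels \<open>0\<close> and \<open>1\<close> give the frequent strings. A label
  \<open>z >= 2\<close> reads a binary digit of \<open>r\<close>, as a Rademacher function does, so
  that any two labels differ on at least half of the active positions once \<open>s\<close> is a
  multiple of a large enough power of two.\<close>

definition pattern :: "nat \<Rightarrow> nat \<Rightarrow> nat \<Rightarrow> bool" where
  "pattern s z r \<longleftrightarrow> r < s \<and> z \<noteq> 0 \<and> (z = 1 \<or> bit r (z - 2))"

text \<open>A bit below \<open>L\<close> does not affect the quotient by \<open>2 ^ L\<close>, so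
  flipping it stays inside the same block of \<open>2 ^ L\<close> numbers.\<close>

lemma flip_bit_less:
  fixes r :: nat
  assumes "r < 2 ^ L * t" and "l < L"
  shows "flip_bit l r < 2 ^ L * t"
proof -
  have "drop_bit L (flip_bit l r) = drop_bit L r"
    using assms(2) by (intro bit_eqI) (auto simp: bit_drop_bit_eq bit_flip_bit_iff)
  then have "flip_bit l r div 2 ^ L = r div 2 ^ L"
    by (simp add: drop_bit_eq_div)
  with assms(1) show ?thesis
    by (metis div_less_iff_less_mult mult.commute zero_less_numeral zero_less_power)
qed

text \<open>Take \<open>z < z'\<close>. If \<open>z' >= 2\<close>, flipping bit
  \<open>z' - 2\<close> negates the pattern of \<open>z'\<close> and leaves that of every smaller
  label unchanged. Otherwise the labels are \<open>0\<close> and \<open>1\<close>, which differ on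
  all of \<open>{..<s}\<close>.\<close>

lemma pattern_disagree_ge:
  assumes s: "s = 2 ^ L * t" and "z < L + 2" "z' < L + 2" "z \<noteq> z'"
  shows "s \<le> 2 * card {r. r < s \<and> pattern s z r \<noteq> pattern s z' r}"
  using assms(2-4)
proof (induction z z' rule: linorder_wlog)
  case (le z z')
  show ?case
  proof (cases "z' = 1")
    case True
    with le have "z = 0" by simp
    with True have "{r. r < s \<and> pattern s z r \<noteq> pattern s z' r} = {..<s}"
      by (auto simp: pattern_def)
    then show ?thesis by simp
  next
    case False
    define l where "l = z' - 2"
    have l: "l < L" "z' = l + 2" using False le by (auto simp: l_def)
    have less: "flip_bit l r < s" if "r < s" for r
      using flip_bit_less l(1) that s by blast
    have invol: "flip_bit l (flip_bit l r) = r" for r :: nat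
      by (rule bit_eqI) (auto simp: bit_flip_bit_iff)
    show ?thesis
    proof (rule card_disagree_ge[of s "flip_bit l"])
      show "inj_on (flip_bit l) {..<s}"
        using invol by (metis inj_onI)
    qed (use le l less in \<open>auto simp: pattern_def bit_flip_bit_iff\<close>)
  qed
next
  case (sym z z')
  have "{r. r < s \<and> pattern s z r \<noteq> pattern s z' r} = {r. r < s \<and> pattern s z' r \<noteq> pattern s z r}"
    by auto
  with sym show ?case by simp
qed

text \<open>The random set of active positions is encoded by a permutation: position
  \<open>j\<close> is active iff \<open>\<pi> j < s\<close>. Averaging over the set becomes counting
  permutations.\<close>

definition codeword :: "nat \<Rightarrow> nat \<Rightarrow> (nat \<Rightarrow> nat) \<Rightarrow> nat \<Rightarrow> bool list" where
  "codeword n s \<pi> z = map (\<lambda>j. pattern s z (\<pi> j)) [0..<n]"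

lemma codeword_in_cube: "codeword n s \<pi> z \<in> cube n"
  by (simp add: codeword_def cube_def)

lemma hamming_dist_codeword_ge:
  assumes "\<pi> permutes {..<n}" and "s = 2 ^ L * t" and "s \<le> n"
    and "z < L + 2" "z' < L + 2" "z \<noteq> z'"
  shows "hamming_dist n (codeword n s \<pi> z) (codeword n s \<pi> z') \<ge> real s / (2 * real n)"
proof -
  let ?A = "{r. r < s \<and> pattern s z r \<noteq> pattern s z' r}"
  let ?B = "{i. i < n \<and> codeword n s \<pi> z ! i \<noteq> codeword n s \<pi> z' ! i}"
  have "?A \<subseteq> \<pi> ` ?B"
  proof
    fix r assume r: "r \<in> ?A"
    then have "r \<in> \<pi> ` {..<n}"
      using assms(1,3) by (simp add: permutes_image)
    then obtain i where "i < n" "r = \<pi> i" by auto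
    with r show "r \<in> \<pi> ` ?B" by (auto simp: codeword_def)
  qed
  then have "card ?A \<le> card ?B"
    using surj_card_le[of ?B ?A \<pi>] by simp
  then have "s \<le> 2 * card ?B"
    using pattern_disagree_ge[OF assms(2,4-6)] by linarith
  then have "real s \<le> 2 * real (card ?B)" by linarith
  then show ?thesis
    unfolding hamming_dist_def by (simp add: divide_simps)
qed

section \<open>Earth mover's distance to distributions of small support\<close>

lemma hamming_dist_commute: "hamming_dist n u v = hamming_dist n v u"
  by (simp add: hamming_dist_def eq_commute)

lemma hamming_dist_nonneg: "hamming_dist n u v \<ge> 0"
  by (simp add: hamming_dist_def)

lemma hamming_dist_le_1: "hamming_dist n u v \<le> 1"
proof -
  have "card {i. i < n \<and> u ! i \<noteq> v ! i} \<le> card {..<n}"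
    by (rule card_mono) auto
  then show ?thesis by (simp add: hamming_dist_def divide_simps)
qed

lemma hamming_dist_triangle: "hamming_dist n u w \<le> hamming_dist n u v + hamming_dist n v w"
proof -
  have "card {i. i < n \<and> u ! i \<noteq> w ! i}
      \<le> card ({i. i < n \<and> u ! i \<noteq> v ! i} \<union> {i. i < n \<and> v ! i \<noteq> w ! i})"
    by (rule card_mono) auto
  also have "\<dots> \<le> card {i. i < n \<and> u ! i \<noteq> v ! i} + card {i. i < n \<and> v ! i \<noteq> w ! i}"
    by (rule card_Un_le)
  finally show ?thesis
    unfolding hamming_dist_def by (simp add: add_divide_distrib[symmetric] divide_right_mono)
qed

text \<open>Each point of the support of \<open>Q\<close> is close to at most one of the \<open>M\<close> separated strings, so
  at least \<open>M - m\<close> of them are far from all of the support.\<close>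

lemma emd_ge_packing:
  fixes x :: "nat \<Rightarrow> bool list" and I :: "nat pmf"
  assumes sep: "\<And>z z'. z < M \<Longrightarrow> z' < M \<Longrightarrow> z \<noteq> z' \<Longrightarrow> hamming_dist n (x z) (x z') \<ge> 2 * \<delta>"
    and mass: "\<And>z. z < M \<Longrightarrow> pmf I z \<ge> \<mu>" and "\<mu> \<ge> 0" and "\<delta> \<ge> 0"
    and Q: "finite (set_pmf Q)" "card (set_pmf Q) \<le> m"
  shows "emd n (map_pmf x I) Q \<ge> \<delta> * (\<mu> * (real M - real m))"
  unfolding emd_def
proof (rule cINF_greatest)
  \<comment> \<open>The infimum is taken over reals, so the set of couplings must be nonempty; the
    independent coupling is a witness.\<close>
  have "pair_pmf (map_pmf x I) Q \<in> couplings (map_pmf x I) Q"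
    by (simp add: couplings_def map_fst_pair_pmf map_snd_pair_pmf)
  then show "couplings (map_pmf x I) Q \<noteq> {}" by blast
next
  fix T assume "T \<in> couplings (map_pmf x I) Q"
  then have fst: "map_pmf fst T = map_pmf x I" and snd: "map_pmf snd T = Q"
    by (auto simp: couplings_def)
  define C where "C = {z. z < M \<and> (\<exists>y \<in> set_pmf Q. hamming_dist n (x z) y < \<delta>)}"
  define F where "F = {..<M} - C"
  have "\<forall>z \<in> C. \<exists>y. y \<in> set_pmf Q \<and> hamming_dist n (x z) y < \<delta>"
    by (auto simp: C_def)
  then obtain f where f: "\<And>z. z \<in> C \<Longrightarrow> f z \<in> set_pmf Q"
      "\<And>z. z \<in> C \<Longrightarrow> hamming_dist n (x z) (f z) < \<delta>"
    by metis
  have "inj_on f C"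
  proof (rule inj_onI, rule ccontr)
    fix z z' assume z: "z \<in> C" "z' \<in> C" "f z = f z'" "z \<noteq> z'"
    then have "2 * \<delta> \<le> hamming_dist n (x z) (x z')"
      by (intro sep) (auto simp: C_def)
    also have "\<dots> \<le> hamming_dist n (x z) (f z) + hamming_dist n (x z') (f z')"
      using hamming_dist_triangle[of n "x z" "x z'" "f z"] z(3)
      by (simp add: hamming_dist_commute)
    also have "\<dots> < 2 * \<delta>" using f(2)[OF z(1)] f(2)[OF z(2)] by simp
    finally show False by simp
  qed
  then have "card C \<le> card (set_pmf Q)"
    using f(1) Q(1) by (intro card_inj_on_le[of f]) auto
  with Q(2) have "card C \<le> m" by simp
  moreover have "card F = M - card C"
    unfolding F_def by (subst card_Diff_subset) (auto simp: C_def)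
  ultimately have cardF: "real M - real m \<le> real (card F)" by linarith
  have "finite F" by (simp add: F_def)
  have "\<mu> * (real M - real m) \<le> (\<Sum>z\<in>F. \<mu>)"
    using cardF \<open>\<mu> \<ge> 0\<close> by (simp add: mult.commute mult_left_mono)
  also have "\<dots> \<le> (\<Sum>z\<in>F. pmf I z)"
    using mass by (intro sum_mono) (auto simp: F_def)
  also have "\<dots> = measure_pmf.prob I F"
    using \<open>finite F\<close> by (simp add: measure_measure_pmf_finite)
  \<comment> \<open>Only an inequality, since \<open>x\<close> may map indices outside
    \<open>F\<close> into the image of \<open>F\<close>.\<close>
  also have "\<dots> \<le> measure_pmf.prob I (x -` (x ` F))"
    by (intro measure_pmf.finite_measure_mono) auto
  also have "\<dots> = measure_pmf.prob (map_pmf fst T) (x ` F)"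
    by (simp add: fst)
  also have "\<dots> = measure_pmf.prob T (fst -` (x ` F))"
    by simp
  finally have prob: "\<mu> * (real M - real m) \<le> measure_pmf.prob T (fst -` (x ` F))" .
  \<comment> \<open>Under any coupling the second component lies in the support of \<open>Q\<close>,
    so a first component in the image of \<open>F\<close> costs at least
    \<open>\<delta>\<close>.\<close>
  have "\<delta> * (\<mu> * (real M - real m)) \<le> \<delta> * measure_pmf.prob T (fst -` (x ` F))"
    using prob \<open>\<delta> \<ge> 0\<close> by (rule mult_left_mono)
  also have "\<dots> = measure_pmf.expectation T (\<lambda>p. \<delta> * indicator (fst -` (x ` F)) p)"
    by simp
  also have "\<dots> \<le> measure_pmf.expectation T (\<lambda>(u, v). hamming_dist n u v)"
  proof (rule integral_mono_AE)
    show "integrable T (\<lambda>p. \<delta> * indicator (fst -` (x ` F)) p)"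
      by (intro measure_pmf.integrable_const_bound[where B = \<delta>])
         (use \<open>\<delta> \<ge> 0\<close> in \<open>auto simp: indicator_def\<close>)
    show "integrable T (\<lambda>(u, v). hamming_dist n u v)"
      by (intro measure_pmf.integrable_const_bound[where B = 1])
         (auto simp: hamming_dist_nonneg hamming_dist_le_1)
    show "AE p in T. \<delta> * indicator (fst -` (x ` F)) p \<le> (\<lambda>(u, v). hamming_dist n u v) p"
    proof (rule AE_pmfI)
      fix p assume "p \<in> set_pmf T"
      then have "snd p \<in> set_pmf Q" using snd by (auto simp flip: snd)
      then show "\<delta> * indicator (fst -` (x ` F)) p \<le> (\<lambda>(u, v). hamming_dist n u v) p"
        by (cases p) (force simp: indicator_def F_def C_def hamming_dist_nonneg not_le)
    qed
  qed
  finally show "\<delta> * (\<mu> * (real M - real m))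
    \<le> measure_pmf.expectation T (\<lambda>(u, v). hamming_dist n u v)" .
qed

lemma finite_cube: "finite (cube n)"
  using finite_lists_length_eq[of "UNIV :: bool set" n] by (simp add: cube_def)

lemma small_support_nonempty:
  assumes "m \<ge> 1" shows "small_support n m \<noteq> {}"
proof -
  have "return_pmf (replicate n True) \<in> small_support n m"
    using assms by (simp add: small_support_def cube_def)
  then show ?thesis by blast
qed

section \<open>The hard inputs and their farness\<close>

text \<open>The labels from \<open>2\<close> on index the rare strings, so \<open>\<rho>\<close> is
  the total rare mass.\<close>

definition labels :: "real \<Rightarrow> nat \<Rightarrow> nat pmf" where
  "labels \<rho> L = bind_pmf (bernoulli_pmf \<rho>) (\<lambda>b. pmf_of_set (if b then {2..<L + 2} else {0, 1}))"

lemma pmf_labels: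
  assumes "0 \<le> \<rho>" "\<rho> \<le> 1" "L \<ge> 1"
  shows "pmf (labels \<rho> L) z = \<rho> * indicator {2..<L + 2} z / real L + (1 - \<rho>) * indicator {0, 1} z / 2"
  using assms by (simp add: labels_def pmf_bind mult.commute)

text \<open>A frequent label has mass at least \<open>1 / 4\<close>, which is no less than the mass
  \<open>\<rho> / L\<close> of a rare one. The packing bound needs one lower bound for all
  labels.\<close>

lemma pmf_labels_ge:
  assumes "0 \<le> \<rho>" "\<rho> \<le> 1 / 2" "L \<ge> 2" "z < L + 2"
  shows "pmf (labels \<rho> L) z \<ge> \<rho> / real L"
proof (cases "z \<in> {0, 1}")
  case True
  have "\<rho> / real L \<le> (1 / 2) / 2"
    using assms by (intro frac_le) auto
  also have "\<dots> \<le> (1 - \<rho>) / 2" using assms by simp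
  finally show ?thesis using assms True by (auto simp: pmf_labels)
next
  case False
  then have "z \<in> {2..<L + 2}" using assms by auto
  with False show ?thesis using assms by (simp add: pmf_labels)
qed

lemma prob_labels_ge_2:
  assumes "0 \<le> \<rho>" "\<rho> \<le> 1" "L \<ge> 1"
  shows "measure_pmf.prob (labels \<rho> L) {2..} = \<rho>"
proof -
  have "set_pmf (labels \<rho> L) \<subseteq> {..<L+2}"
    using assms by (auto simp: labels_def)
  then have "measure_pmf.prob (labels \<rho> L) {2..} = measure_pmf.prob (labels \<rho> L) {2..<L + 2}"
    by (intro measure_pmf.finite_measure_eq_AE AE_pmfI) auto
  also have "\<dots> = \<rho>"
    using assms by (simp add: measure_measure_pmf_finite pmf_labels)
  finally show ?thesis .
qed

text \<open>The \<open>2 m + 2\<close> codewords are pairwise \<open>s / (2 n)\<close> apart. A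
  support of size \<open>m\<close> leaves at least \<open>m + 2\<close> of them at distance
  \<open>s / (4 n)\<close> or more, and their labels carry mass at least
  \<open>\<rho> / 2\<close>.\<close>

lemma far_from_hard:
  assumes "\<pi> permutes {..<n}" and "s = 2 ^ (2 * m) * t" and "s \<le> n" and "m \<ge> 2"
    and "0 \<le> \<rho>" "\<rho> \<le> 1 / 2" and "n > 0" and "\<epsilon> < \<rho> * real s / (8 * real n)"
  shows "far_from n \<epsilon> (map_pmf (codeword n s \<pi>) (labels \<rho> (2 * m))) (small_support n m)"
proof -
  let ?P = "map_pmf (codeword n s \<pi>) (labels \<rho> (2 * m))"
  define \<delta> where "\<delta> = real s / (4 * real n)"
  define b where "b = \<delta> * (\<rho> / real (2 * m) * (real (2 * m + 2) - real m))"
  have "b \<le> emd n ?P Q" if "Q \<in> small_support n m" for Q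
    unfolding b_def
  proof (rule emd_ge_packing)
    show "2 * \<delta> \<le> hamming_dist n (codeword n s \<pi> z) (codeword n s \<pi> z')"
      if "z < 2 * m + 2" "z' < 2 * m + 2" "z \<noteq> z'" for z z'
      using hamming_dist_codeword_ge[OF assms(1-3) that] by (simp add: \<delta>_def)
    show "\<rho> / real (2 * m) \<le> pmf (labels \<rho> (2 * m)) z" if "z < 2 * m + 2" for z
      using assms that by (intro pmf_labels_ge) auto
    show "finite (set_pmf Q)" "card (set_pmf Q) \<le> m"
      using that finite_cube finite_subset by (auto simp: small_support_def)
  qed (use assms in \<open>auto simp: \<delta>_def\<close>)
  then have "b \<le> (INF Q \<in> small_support n m. emd n ?P Q)"
    using small_support_nonempty[of m n] assms(4) by (intro cINF_greatest) auto
  moreover have "\<epsilon> < b"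
  proof -
    have "\<rho> * real s / (8 * real n) = \<delta> * (\<rho> / real (2 * m) * real m)"
      using assms by (simp add: \<delta>_def)
    also have "\<dots> \<le> b"
      unfolding b_def using assms by (intro mult_left_mono) (auto simp: \<delta>_def)
    finally show ?thesis using assms(8) by simp
  qed
  ultimately show ?thesis by (simp add: far_from_def)
qed


section \<open>Counting permutations, and a dyadic sum\<close>

lemma finite_permutes_lessThan: "finite {\<pi>. \<pi> permutes {..<n::nat}}"
  by (rule finite_permutations) simp

lemma card_filter_eq_sum:
  assumes "finite A" shows "card {x \<in> A. R x} = (\<Sum>x\<in>A. of_bool (R x))"
  using assms by (simp add: Int_def)

lemma card_off_diagonal:
  "card {p. fst p < n \<and> snd p < n \<and> fst p \<noteq> snd p} = n * n - (n::nat)"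
proof -
  have "{p. fst p < n \<and> snd p < n \<and> fst p \<noteq> snd p} = {..<n} \<times> {..<n} - (\<lambda>i. (i, i)) ` {..<n}"
    by auto
  moreover have "card ({..<n} \<times> {..<n} - (\<lambda>i. (i, i)) ` {..<n}) = n * n - n"
    by (subst card_Diff_subset) (auto simp: card_image inj_on_def)
  ultimately show ?thesis by simp
qed

lemma card_permutes_pair_eq:
  assumes "i < n" "i' < n" "i \<noteq> i'" "j < n" "j' < n" "j \<noteq> j'"
  shows "card {\<pi>. \<pi> permutes {..<n} \<and> \<pi> i < s \<and> \<pi> i' < s}
       = card {\<pi>. \<pi> permutes {..<n} \<and> \<pi> j < s \<and> \<pi> j' < (s::nat)}"
proof -
  \<comment> \<open>The first swap sends \<open>i\<close> to \<open>j\<close>; the second sends the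
    resulting image of \<open>i'\<close> to \<open>j'\<close> and fixes \<open>j\<close>, because
    that image and \<open>j'\<close> both differ from \<open>j\<close>.\<close>
  define \<tau> where "\<tau> = Transposition.transpose j' (Transposition.transpose i j i') \<circ> Transposition.transpose i j"
  have \<tau>: "\<tau> permutes {..<n}"
    unfolding \<tau>_def using assms
    by (intro permutes_compose permutes_swap_id) (auto simp: Transposition.transpose_def)
  have \<tau>i: "\<tau> i = j" "\<tau> i' = j'"
    using assms by (auto simp: \<tau>_def Transposition.transpose_def)
  have inv: "inv \<tau> permutes {..<n}" using \<tau> by (rule permutes_inv)
  have inv_j: "inv \<tau> j = i" "inv \<tau> j' = i'"
    using permutes_inverses(2)[OF \<tau>, of i] permutes_inverses(2)[OF \<tau>, of i'] \<tau>i by simp_all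
  have "bij_betw (\<lambda>\<pi>. \<pi> \<circ> \<tau>) {\<pi>. \<pi> permutes {..<n} \<and> \<pi> j < s \<and> \<pi> j' < s}
      {\<pi>. \<pi> permutes {..<n} \<and> \<pi> i < s \<and> \<pi> i' < s}"
  proof (rule bij_betw_byWitness[where f' = "\<lambda>\<pi>. \<pi> \<circ> inv \<tau>"])
    show "\<forall>\<pi>\<in>{\<pi>. \<pi> permutes {..<n} \<and> \<pi> j < s \<and> \<pi> j' < s}. \<pi> \<circ> \<tau> \<circ> inv \<tau> = \<pi>"
      by (simp add: comp_assoc permutes_inv_o[OF \<tau>])
    show "\<forall>\<pi>\<in>{\<pi>. \<pi> permutes {..<n} \<and> \<pi> i < s \<and> \<pi> i' < s}. \<pi> \<circ> inv \<tau> \<circ> \<tau> = \<pi>"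
      by (simp add: comp_assoc permutes_inv_o[OF \<tau>])
  qed (auto simp: inv_j \<tau>i intro: permutes_compose \<tau> inv)
  then show ?thesis by (rule bij_betw_same_card[symmetric])
qed

text \<open>Double counting: all ordered pairs of distinct positions have the same count
  \<open>N\<close>, and every permutation sends exactly \<open>s (s - 1)\<close> of these pairs
  below \<open>s\<close>. Hence \<open>N\<close> is \<open>n!\<close> times
  \<open>s (s - 1) / (n (n - 1))\<close>.\<close>

lemma card_permutes_pair_le:
  assumes "j < n" "j' < n" "j \<noteq> j'" "s \<le> n"
  shows "real (card {\<pi>. \<pi> permutes {..<n} \<and> \<pi> j < s \<and> \<pi> j' < s}) \<le> fact n * (real s / real n)\<^sup>2"
proof -
  define D where "D = {p. fst p < n \<and> snd p < n \<and> fst p \<noteq> snd p}"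
  define N where "N = card {\<pi>. \<pi> permutes {..<n} \<and> \<pi> j < s \<and> \<pi> j' < s}"
  let ?P = "{\<pi>. \<pi> permutes {..<n}}"
  have "finite D"
    by (rule finite_subset[of _ "{..<n} \<times> {..<n}"]) (auto simp: D_def)
  have "card D * N = (\<Sum>p\<in>D. N)" by simp
  also have "\<dots> = (\<Sum>p\<in>D. card {\<pi>\<in>?P. \<pi> (fst p) < s \<and> \<pi> (snd p) < s})"
  proof (rule sum.cong[OF refl])
    fix p assume "p \<in> D"
    then show "N = card {\<pi>\<in>?P. \<pi> (fst p) < s \<and> \<pi> (snd p) < s}"
      unfolding N_def D_def mem_Collect_eq
      by (intro card_permutes_pair_eq) (use assms in auto)
  qed
  also have "\<dots> = (\<Sum>p\<in>D. \<Sum>\<pi>\<in>?P. of_bool (\<pi> (fst p) < s \<and> \<pi> (snd p) < s))"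
    by (intro sum.cong refl card_filter_eq_sum finite_permutes_lessThan)
  also have "\<dots> = (\<Sum>\<pi>\<in>?P. \<Sum>p\<in>D. of_bool (\<pi> (fst p) < s \<and> \<pi> (snd p) < s))"
    by (rule sum.swap)
  also have "\<dots> = (\<Sum>\<pi>\<in>?P. card {p\<in>D. \<pi> (fst p) < s \<and> \<pi> (snd p) < s})"
    by (intro sum.cong refl card_filter_eq_sum[symmetric] \<open>finite D\<close>)
  also have "\<dots> = (\<Sum>\<pi>\<in>?P. s * s - s)"
  proof (rule sum.cong[OF refl])
    fix \<pi> assume "\<pi> \<in> ?P"
    then have \<pi>: "\<pi> permutes {..<n}" by simp
    then have inv: "inv \<pi> permutes {..<n}" by (rule permutes_inv)
    have lt: "inv \<pi> r < n" if "r < s" for r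
      using permutes_in_image[OF inv, of r] that assms(4) by simp
    have "bij_betw (map_prod \<pi> \<pi>) {p\<in>D. \<pi> (fst p) < s \<and> \<pi> (snd p) < s}
        {p. fst p < s \<and> snd p < s \<and> fst p \<noteq> snd p}"
      by (rule bij_betw_byWitness[where f' = "map_prod (inv \<pi>) (inv \<pi>)"])
         (use lt \<pi> inv in \<open>auto simp: D_def permutes_inverses inj_eq[OF permutes_inj]\<close>)
    then show "card {p\<in>D. \<pi> (fst p) < s \<and> \<pi> (snd p) < s} = s * s - s"
      by (simp add: bij_betw_same_card card_off_diagonal)
  qed
  also have "\<dots> = fact n * (s * s - s)"
    using card_permutations[of "{..<n}" n] by simp
  finally have "(n * n - n) * N = fact n * (s * s - s)"
    by (simp add: D_def card_off_diagonal)
  then have "real ((n * n - n) * N) = real (fact n * (s * s - s))" by (rule arg_cong)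
  then have eq: "real n * (real n - 1) * real N = fact n * (real s * (real s - 1))"
    by (simp add: of_nat_diff algebra_simps)
  have n: "real n \<ge> 2" using assms by linarith
  \<comment> \<open>What remains is \<open>(s - 1) / (n - 1) <= s / n\<close>, proved with the
    denominators multiplied out.\<close>
  have "(real n - 1) * (real n * real n * real N) = real n * (real n * (real n - 1) * real N)"
    by (simp only: ac_simps)
  also have "\<dots> = fact n * real s * (real n * (real s - 1))"
    unfolding eq by (simp only: ac_simps)
  also have "\<dots> \<le> fact n * real s * (real s * (real n - 1))"
  proof (rule mult_left_mono)
    show "real n * (real s - 1) \<le> real s * (real n - 1)"
      using assms(4) by (simp add: right_diff_distrib mult.commute)
  qed simp
  also have "\<dots> = (real n - 1) * (fact n * (real s * real s))"
    by (simp only: ac_simps)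
  finally have "real n * real n * real N \<le> fact n * (real s * real s)"
    using n by simp
  then have "real N \<le> fact n * (real s * real s) / (real n * real n)"
    using n by (subst pos_le_divide_eq) (simp_all only: ac_simps, simp)
  then show ?thesis
    by (simp add: N_def power2_eq_square)
qed

text \<open>A union bound over the pairs from \<open>Q\<close> gives the square, and the number of
  all permutations gives the cap \<open>1\<close>.\<close>

lemma card_permutes_two_hits_le:
  assumes "Q \<subseteq> {..<n}" "s \<le> n"
  shows "real (card {\<pi>. \<pi> permutes {..<n} \<and> 2 \<le> card {j \<in> Q. \<pi> j < s}})
    \<le> fact n * min 1 ((real (card Q) * real s / real n)\<^sup>2)"
proof -
  let ?G = "{\<pi>. \<pi> permutes {..<n} \<and> 2 \<le> card {j \<in> Q. \<pi> j < s}}"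
  let ?P = "{\<pi>. \<pi> permutes {..<n}}"
  let ?H = "\<lambda>p. {\<pi>. \<pi> permutes {..<n} \<and> \<pi> (fst p) < s \<and> \<pi> (snd p) < s}"
  define E where "E = {p \<in> Q \<times> Q. fst p \<noteq> snd p}"
  have "finite Q" using assms(1) finite_subset by blast
  then have finE: "finite E" by (simp add: E_def)
  have "card E \<le> card (Q \<times> Q)"
    by (rule card_mono) (auto simp: E_def \<open>finite Q\<close>)
  then have cardE: "real (card E) \<le> (real (card Q))\<^sup>2"
    by (simp add: power2_eq_square card_cartesian_product flip: of_nat_mult)
  have "?G \<subseteq> (\<Union>p\<in>E. ?H p)"
  proof
    fix \<pi> assume \<pi>: "\<pi> \<in> ?G"
    have "\<not> card {j \<in> Q. \<pi> j < s} \<le> Suc 0" using \<pi> by simp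
    then obtain j j' where "j \<in> Q" "j' \<in> Q" "j \<noteq> j'" "\<pi> j < s" "\<pi> j' < s"
      using card_le_Suc0_iff_eq[of "{j \<in> Q. \<pi> j < s}"] \<open>finite Q\<close> by auto
    with \<pi> show "\<pi> \<in> (\<Union>p\<in>E. ?H p)"
      by (auto simp: E_def intro!: bexI[of _ "(j, j')"])
  qed
  then have "card ?G \<le> card (\<Union>p\<in>E. ?H p)"
    by (rule card_mono[rotated]) (use finE finite_permutes_lessThan in auto)
  also have "\<dots> \<le> (\<Sum>p\<in>E. card (?H p))"
    using finE by (rule card_UN_le)
  finally have "real (card ?G) \<le> (\<Sum>p\<in>E. real (card (?H p)))"
    by (simp flip: of_nat_sum)
  also have "\<dots> \<le> (\<Sum>p\<in>E. fact n * (real s / real n)\<^sup>2)"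
    using assms by (intro sum_mono card_permutes_pair_le) (auto simp: E_def)
  also have "\<dots> \<le> (real (card Q))\<^sup>2 * (fact n * (real s / real n)\<^sup>2)"
    using cardE by (simp add: mult_right_mono)
  finally have 1: "real (card ?G) \<le> fact n * (real (card Q) * real s / real n)\<^sup>2"
    by (simp add: power_mult_distrib power_divide algebra_simps)
  have "card ?G \<le> card ?P"
    by (rule card_mono) (auto simp: finite_permutes_lessThan)
  also have "\<dots> = fact n"
    by (rule card_permutations) auto
  finally have "real (card ?G) \<le> real (fact n)"
    by (rule of_nat_mono)
  with 1 show ?thesis by (simp add: min_def)
qed

text \<open>The terms grow like \<open>2 ^ k\<close> up to about \<open>q\<close> and then decay
  like \<open>q^2 / 2 ^ k\<close>, so both sides are geometric and the bound does not depend on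
  \<open>K\<close>.\<close>

lemma sum_dyadic_min_le:
  fixes q :: nat
  shows "(\<Sum>k<K. 2 ^ k * min 1 ((real q / 2 ^ k)\<^sup>2)) \<le> 4 * real q"
proof (cases "q = 0")
  case False
  \<comment> \<open>An invariant strong enough for induction: before the turning point, the bound
    \<open>2 ^ K\<close> on the partial geometric sum; after it, \<open>4 q\<close> less the whole
    remaining tail, the sum of \<open>q^2 / 2 ^ k\<close> over \<open>k >= K\<close>.\<close>
  define b where "b K = (if (2::real) ^ K \<le> 2 * real q then 2 ^ K else 4 * real q - 2 * (real q)\<^sup>2 / 2 ^ K)"
    for K :: nat
  have "(\<Sum>k<K. 2 ^ k * min 1 ((real q / 2 ^ k)\<^sup>2)) \<le> b K"
  proof (induction K)
    case 0
    show ?case using False by (simp add: b_def)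
  next
    case (Suc K)
    define x :: real where "x = 2 ^ K"
    have x: "x > 0" by (simp add: x_def)
    have "b K + x * min 1 ((real q / x)\<^sup>2) \<le> b (Suc K)"
    proof -
      consider "2 * x \<le> 2 * real q" | "x \<le> 2 * real q" "2 * real q < 2 * x" | "2 * real q < x"
        by linarith
      then show ?thesis
      proof cases
        case 1
        moreover have "x * min 1 ((real q / x)\<^sup>2) \<le> x * 1"
          using x by (intro mult_left_mono) auto
        ultimately show ?thesis
          using x by (simp add: b_def flip: x_def)
      next
        case 2
        have "x * min 1 ((real q / x)\<^sup>2) \<le> x * (real q / x)\<^sup>2"
          using x by (intro mult_left_mono) auto
        also have "\<dots> = (real q)\<^sup>2 / x"
          using x by (simp add: power2_eq_square)
        finally have 3: "x * min 1 ((real q / x)\<^sup>2) \<le> (real q)\<^sup>2 / x" .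
        \<comment> \<open>This is the step where \<open>b\<close> changes its form. Here
          \<open>x\<close> lies between \<open>q\<close> and \<open>2 q\<close>, and the claim
          reduces to \<open>x^2 + 2 q^2 <= 4 x q\<close>.\<close>
        have "(x - real q) * (2 * real q - x) \<ge> 0"
          using 2 by simp
        then have "x * x + 2 * (real q)\<^sup>2 \<le> 3 * (x * real q)"
          by (simp add: algebra_simps power2_eq_square)
        also have "\<dots> \<le> 4 * (x * real q)" using x by simp
        finally have "(x * x + 2 * (real q)\<^sup>2) / x \<le> 4 * (x * real q) / x"
          using x by (intro divide_right_mono) auto
        then have "x + (real q)\<^sup>2 / x \<le> 4 * real q - 2 * (real q)\<^sup>2 / (2 * x)"
          using x by (simp add: add_divide_distrib)
        with 3 2 show ?thesis
          by (simp add: b_def flip: x_def)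
      next
        case 3
        have "x * min 1 ((real q / x)\<^sup>2) \<le> x * (real q / x)\<^sup>2"
          using x by (intro mult_left_mono) auto
        also have "\<dots> = (real q)\<^sup>2 / x"
          using x by (simp add: power2_eq_square)
        finally have "x * min 1 ((real q / x)\<^sup>2) \<le> (real q)\<^sup>2 / x" .
        with 3 x show ?thesis
          by (simp add: b_def flip: x_def)
      qed
    qed
    with Suc show ?case by (simp add: x_def)
  qed
  also have "b K \<le> 4 * real q"
    by (auto simp: b_def)
  finally show ?thesis .
qed simp


section \<open>What a one-sided test can reject\<close>

definition answers :: "plan \<Rightarrow> bool list list \<Rightarrow> bool list" where
  "answers a X = map (\<lambda>(i, j). X ! i ! j) (queries a)"

definition run :: "plan \<Rightarrow> bool list pmf \<Rightarrow> bool pmf" where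
  "run a P = map_pmf (\<lambda>X. decide a (answers a X)) (replicate_pmf (num_samples a) P)"

lemma verdict_eq_run: "verdict A P = bind_pmf A (\<lambda>a. run a P)"
  by (simp add: verdict_def run_def answers_def)

definition queried :: "plan \<Rightarrow> nat \<Rightarrow> nat set" where
  "queried a i = {j. (i, j) \<in> set (queries a)}"

lemma finite_queried: "finite (queried a i)"
  by (rule finite_subset[of _ "snd ` set (queries a)"]) (force simp: queried_def)+

lemma sum_card_queried_le: "(\<Sum>i<N. card (queried a i)) \<le> length (queries a)"
proof -
  have "(\<Sum>i<N. card (queried a i)) = card (SIGMA i:{..<N}. queried a i)"
    by (simp add: finite_queried)
  also have "\<dots> \<le> card (set (queries a))"
    by (rule card_mono) (auto simp: queried_def)
  also have "\<dots> \<le> length (queries a)" by (rule card_length)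
  finally show ?thesis .
qed

text \<open>One-sided error: samples with at most \<open>m\<close> distinct values have positive probability under
  the uniform distribution on those values, so their answers must be accepted.\<close>

lemma decide_of_few_values:
  assumes test: "one_sided_test n m \<epsilon> A" and a: "a \<in> set_pmf A" and "m \<ge> 1"
    and X: "length X = num_samples a" "set X \<subseteq> cube n" "card (set X) \<le> m"
  shows "decide a (answers a X)"
proof -
  obtain P where P: "P \<in> small_support n m" "set X \<subseteq> set_pmf P"
  proof (cases "X = []")
    case True
    then show ?thesis using that small_support_nonempty[OF \<open>m \<ge> 1\<close>] by fastforce
  next
    case False
    then show ?thesis
      using that[of "pmf_of_set (set X)"] X by (simp add: small_support_def)
  qed
  \<comment> \<open>Acceptance with probability \<open>1\<close> excludes rejection for every plan
    and every sample list of positive probability.\<close>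
  have "pmf (verdict A P) True = 1"
    using test P(1) by (simp add: one_sided_test_def)
  then have "False \<notin> set_pmf (verdict A P)"
    by (simp add: set_pmf_iff pmf_False_conv_True)
  moreover have "X \<in> set_pmf (replicate_pmf (num_samples a) P)"
    using P(2) X(1) by (auto simp: set_replicate_pmf)
  then have "decide a (answers a X) \<in> set_pmf (verdict A P)"
    using a by (auto simp: verdict_eq_run run_def)
  ultimately show ?thesis by metis
qed

text \<open>Two active queries are the fewest that can separate a rare string from both frequent
  ones: a \<open>False\<close> at an active position excludes label \<open>1\<close>, and a
  \<open>True\<close> excludes label \<open>0\<close>.\<close>

definition hits :: "plan \<Rightarrow> nat \<Rightarrow> (nat \<Rightarrow> nat) \<Rightarrow> nat \<Rightarrow> bool" where
  "hits a s \<pi> i \<longleftrightarrow> 2 \<le> card {j \<in> queried a i. \<pi> j < s}"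

text \<open>A sample with a rare label whose queries meet the \<open>s\<close> active positions at most once is
  indistinguishable from codeword \<open>0\<close> or codeword \<open>1\<close>, and can be replaced by it.\<close>

lemma reject_imp_many_hits:
  assumes test: "one_sided_test n m \<epsilon> A" and alg: "nonadaptive_alg n A"
    and a: "a \<in> set_pmf A" and "m \<ge> 2"
    and Z: "length Z = num_samples a"
    and reject: "\<not> decide a (answers a (map (codeword n s \<pi>) Z))"
  shows "m - 1 \<le> card {i. i < num_samples a \<and> 2 \<le> Z ! i \<and> hits a s \<pi> i}"
proof (rule ccontr)
  let ?I = "{i. i < num_samples a \<and> 2 \<le> Z ! i \<and> hits a s \<pi> i}"
  let ?x = "codeword n s \<pi>"
  \<comment> \<open>A rare sample without a hit becomes codeword \<open>1\<close> if some query to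
    it reads \<open>True\<close>, and codeword \<open>0\<close> otherwise.\<close>
  define y where "y i = (if i \<in> ?I then Z ! i else if Z ! i < 2 then Z ! i
     else if \<exists>j \<in> queried a i. pattern s (Z ! i) (\<pi> j) then 1 else 0)" for i
  define X where "X = map (\<lambda>i. ?x (y i)) [0..<num_samples a]"
  assume "\<not> m - 1 \<le> card ?I"
  \<comment> \<open>The \<open>2\<close> makes room for both frequent codewords among the
    \<open>m\<close> allowed values.\<close>
  then have I: "card ?I + 2 \<le> m" by simp
  have "set X \<subseteq> {?x 0, ?x 1} \<union> (\<lambda>i. ?x (Z ! i)) ` ?I"
  proof
    fix w assume "w \<in> set X"
    then obtain i where i: "i < num_samples a" "w = ?x (y i)" by (auto simp: X_def)
    have "y i = 0 \<or> y i = 1 \<or> i \<in> ?I \<and> y i = Z ! i" by (auto simp: y_def)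
    then show "w \<in> {?x 0, ?x 1} \<union> (\<lambda>i. ?x (Z ! i)) ` ?I" using i(2) by auto
  qed
  then have "card (set X) \<le> card ({?x 0, ?x 1} \<union> (\<lambda>i. ?x (Z ! i)) ` ?I)"
    by (rule card_mono[rotated]) simp
  also have "\<dots> \<le> card {?x 0, ?x 1} + card ((\<lambda>i. ?x (Z ! i)) ` ?I)"
    by (rule card_Un_le)
  also have "\<dots> \<le> 2 + card ?I"
    by (intro add_mono card_image_le) (auto simp: card_insert_if)
  also have "\<dots> \<le> m" using I by simp
  finally have "card (set X) \<le> m" .
  then have "decide a (answers a X)"
    using \<open>m \<ge> 2\<close> by (intro decide_of_few_values[OF test a]) (auto simp: X_def codeword_in_cube)
  moreover have "answers a X = answers a (map ?x Z)"
    unfolding answers_def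
  proof (rule map_cong[OF refl], clarify)
    fix i j assume ij: "(i, j) \<in> set (queries a)"
    then have lt: "i < num_samples a" "j < n"
      using alg a by (auto simp: nonadaptive_alg_def)
    have "pattern s (y i) (\<pi> j) = pattern s (Z ! i) (\<pi> j)"
    proof (cases "i \<in> ?I \<or> Z ! i < 2")
      case True
      then show ?thesis by (auto simp: y_def)
    next
      case False
      then have "\<not> hits a s \<pi> i" using lt by auto
      then have "card {j \<in> queried a i. \<pi> j < s} \<le> Suc 0" by (simp add: hits_def)
      \<comment> \<open>Inactive positions read \<open>False\<close> under every label. If
        \<open>j\<close> is active, it is the only active query to sample \<open>i\<close>, so its
        value alone decides between codewords \<open>0\<close> and \<open>1\<close>.\<close>
      then have unique: "j' = j" if "j' \<in> queried a i" "\<pi> j' < s" "\<pi> j < s" for j'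
        using that ij finite_queried[of a i]
        by (auto simp: card_le_Suc0_iff_eq queried_def)
      show ?thesis
        using False ij unique by (auto simp: y_def pattern_def queried_def)
    qed
    then show "X ! i ! j = map ?x Z ! i ! j"
      using lt Z by (simp add: X_def codeword_def)
  qed
  ultimately show False using reject by simp
qed

section \<open>Rejection probability on the hard inputs\<close>

lemma replicate_pmf_map: "replicate_pmf N (map_pmf f p) = map_pmf (map f) (replicate_pmf N p)"
  by (induction N) (simp_all add: map_bind_pmf bind_map_pmf)

lemma map_nth_replicate_pmf:
  "i < N \<Longrightarrow> map_pmf (\<lambda>X. X ! i) (replicate_pmf N p) = p"
proof (induction N arbitrary: i)
  case (Suc N)
  then show ?case
    by (cases i) (simp_all add: map_bind_pmf bind_return_pmf' pmf.map_comp o_def flip: map_pmf_def)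
qed simp

lemma prob_nth_replicate_pmf:
  assumes "i < N"
  shows "measure_pmf.prob (replicate_pmf N p) {X. X ! i \<in> S} = measure_pmf.prob p S"
proof -
  have "measure_pmf.prob p S = measure_pmf.prob (map_pmf (\<lambda>X. X ! i) (replicate_pmf N p)) S"
    using assms by (simp add: map_nth_replicate_pmf)
  then show ?thesis by (simp add: vimage_def)
qed

text \<open>Markov's inequality: rejection needs at least \<open>m - 1\<close> rare samples among
  those with a hit, and each sample is rare with probability \<open>\<rho>\<close>.\<close>

lemma prob_reject_le:
  assumes test: "one_sided_test n m \<epsilon> A" and alg: "nonadaptive_alg n A"
    and a: "a \<in> set_pmf A" and "m \<ge> 2" and \<rho>: "0 \<le> \<rho>" "\<rho> \<le> 1"
  shows "pmf (run a (map_pmf (codeword n s \<pi>) (labels \<rho> (2 * m)))) False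
    \<le> \<rho> * real (card {i. i < num_samples a \<and> hits a s \<pi> i}) / (real m - 1)"
proof -
  define N where "N = num_samples a"
  define H where "H = {i. i < N \<and> hits a s \<pi> i}"
  let ?p = "replicate_pmf N (labels \<rho> (2 * m))"
  let ?R = "{Z. \<not> decide a (answers a (map (codeword n s \<pi>) Z))}"
  have "finite H" by (simp add: H_def)
  have int: "integrable ?p (\<lambda>Z. indicator {Z. Z ! i \<in> {2..}} Z :: real)" for i
    by (intro measure_pmf.integrable_const_bound[where B = 1]) (auto simp: indicator_def)
  have "run a (map_pmf (codeword n s \<pi>) (labels \<rho> (2 * m)))
      = map_pmf (\<lambda>Z. decide a (answers a (map (codeword n s \<pi>) Z))) ?p"
    by (simp add: run_def replicate_pmf_map pmf.map_comp o_def N_def)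
  then have "pmf (run a (map_pmf (codeword n s \<pi>) (labels \<rho> (2 * m)))) False * (real m - 1)
      = measure_pmf.prob ?p ?R * (real m - 1)"
    by (simp add: pmf_map vimage_def)
  also have "\<dots> = measure_pmf.expectation ?p (\<lambda>Z. indicator ?R Z * (real m - 1))"
    by simp
  also have "\<dots> \<le> measure_pmf.expectation ?p (\<lambda>Z. \<Sum>i\<in>H. indicator {Z. Z ! i \<in> {2..}} Z)"
  proof (rule integral_mono_AE)
    show "integrable ?p (\<lambda>Z. indicator ?R Z * (real m - 1))"
      by (intro measure_pmf.integrable_const_bound[where B = "real m - 1"])
         (use \<open>m \<ge> 2\<close> in \<open>auto simp: indicator_def\<close>)
    show "integrable ?p (\<lambda>Z. \<Sum>i\<in>H. indicator {Z. Z ! i \<in> {2..}} Z :: real)"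
      using int by (rule Bochner_Integration.integrable_sum)
    show "AE Z in ?p. indicator ?R Z * (real m - 1) \<le> (\<Sum>i\<in>H. indicator {Z. Z ! i \<in> {2..}} Z)"
    proof (rule AE_pmfI)
      fix Z assume "Z \<in> set_pmf ?p"
      then have len: "length Z = num_samples a" by (simp add: set_replicate_pmf N_def)
      show "indicator ?R Z * (real m - 1) \<le> (\<Sum>i\<in>H. indicator {Z. Z ! i \<in> {2..}} Z)"
      proof (cases "Z \<in> ?R")
        case True
        then have "m - 1 \<le> card {i. i < N \<and> 2 \<le> Z ! i \<and> hits a s \<pi> i}"
          unfolding N_def by (intro reject_imp_many_hits[OF test alg a \<open>m \<ge> 2\<close> len]) simp
        also have "{i. i < N \<and> 2 \<le> Z ! i \<and> hits a s \<pi> i} = {i \<in> H. Z ! i \<in> {2..}}"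
          by (auto simp: H_def)
        also have "card \<dots> = (\<Sum>i\<in>H. of_bool (Z ! i \<in> {2..}))"
          using \<open>finite H\<close> by (rule card_filter_eq_sum)
        finally have "real (m - 1) \<le> real (\<Sum>i\<in>H. of_bool (Z ! i \<in> {2..}))"
          by (rule of_nat_mono)
        then show ?thesis
          using True \<open>m \<ge> 2\<close> by (simp add: of_nat_diff indicator_def)
      qed (simp add: sum_nonneg)
    qed
  qed
  also have "\<dots> = (\<Sum>i\<in>H. measure_pmf.prob ?p {Z. Z ! i \<in> {2..}})"
    by (subst Bochner_Integration.integral_sum) (use int in auto)
  also have "\<dots> = (\<Sum>i\<in>H. \<rho>)"
  proof (rule sum.cong[OF refl])
    fix i assume "i \<in> H"
    then have "i < N" by (simp add: H_def)
    then show "measure_pmf.prob ?p {Z. Z ! i \<in> {2..}} = \<rho>"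
      using prob_labels_ge_2[OF \<rho>, of "2 * m"] \<open>m \<ge> 2\<close> by (subst prob_nth_replicate_pmf) auto
  qed
  finally show ?thesis
    using \<open>m \<ge> 2\<close> by (simp add: H_def N_def pos_le_divide_eq mult.commute)
qed

text \<open>Linearity of expectation over a uniformly random permutation, scaled by
  \<open>n!\<close>.\<close>

lemma sum_card_hits_le:
  assumes "nonadaptive_alg n A" "a \<in> set_pmf A" "s \<le> n"
  shows "(\<Sum>\<pi> | \<pi> permutes {..<n}. real (card {i. i < num_samples a \<and> hits a s \<pi> i}))
    \<le> (\<Sum>i<num_samples a. fact n * min 1 ((real (card (queried a i)) * real s / real n)\<^sup>2))"
proof -
  let ?P = "{\<pi>. \<pi> permutes {..<n}}"
  have "(\<Sum>\<pi>\<in>?P. card {i. i < num_samples a \<and> hits a s \<pi> i})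
      = (\<Sum>\<pi>\<in>?P. \<Sum>i<num_samples a. of_bool (hits a s \<pi> i))"
    using card_filter_eq_sum[of "{..<num_samples a}"] by simp
  also have "\<dots> = (\<Sum>i<num_samples a. \<Sum>\<pi>\<in>?P. of_bool (hits a s \<pi> i))"
    by (rule sum.swap)
  also have "\<dots> = (\<Sum>i<num_samples a. card {\<pi>\<in>?P. hits a s \<pi> i})"
    by (intro sum.cong refl card_filter_eq_sum[symmetric] finite_permutes_lessThan)
  finally have "(\<Sum>\<pi>\<in>?P. real (card {i. i < num_samples a \<and> hits a s \<pi> i}))
      = (\<Sum>i<num_samples a. real (card {\<pi>\<in>?P. hits a s \<pi> i}))"
    by (simp flip: of_nat_sum)
  also have "\<dots> \<le> (\<Sum>i<num_samples a. fact n * min 1 ((real (card (queried a i)) * real s / real n)\<^sup>2))"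
  proof (rule sum_mono)
    fix i
    have "queried a i \<subseteq> {..<n}"
      using assms by (auto simp: queried_def nonadaptive_alg_def)
    then show "real (card {\<pi>\<in>?P. hits a s \<pi> i})
        \<le> fact n * min 1 ((real (card (queried a i)) * real s / real n)\<^sup>2)"
      using card_permutes_two_hits_le[OF _ assms(3)] by (simp add: hits_def)
  qed
  finally show ?thesis .
qed

section \<open>Combining the scales\<close>

text \<open>The constant \<open>32\<close> makes the input at scale \<open>k\<close>, with rare mass \<open>32 * \<epsilon> * 2 ^ k\<close>, \<open>\<epsilon>\<close>-far although
  rounding \<open>s k\<close> down to a multiple of \<open>2 ^ (2 * m)\<close> can cost a factor of almost \<open>2\<close>.\<close>

lemma queries_ge_of_scales:
  assumes test: "one_sided_test n m \<epsilon> A" and alg: "nonadaptive_alg n A" and "m \<ge> 2" and "\<epsilon> > 0"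
    and K: "\<And>k. k < K \<Longrightarrow> 32 * \<epsilon> * 2 ^ k \<le> 1 / 2"
    and n: "2 ^ (K + 2 * m) \<le> n"
    and B: "\<And>a. a \<in> set_pmf A \<Longrightarrow> real (length (queries a)) \<le> B"
  shows "real K * (real m - 1) \<le> 192 * \<epsilon> * B"
proof -
  let ?P = "{\<pi>. \<pi> permutes {..<n}}"
  define \<rho> where "\<rho> k = 32 * \<epsilon> * 2 ^ k" for k :: nat
  define s where "s k = 2 ^ (2 * m) * (n div 2 ^ (k + 2 * m))" for k :: nat
  define hard where "hard k \<pi> = map_pmf (codeword n (s k) \<pi>) (labels (\<rho> k) (2 * m))" for k \<pi>
  have "n > 0" using n by (metis gr0I le_zero_eq power_not_zero zero_neq_numeral)
  have \<rho>: "0 \<le> \<rho> k" "\<rho> k \<le> 1 / 2" if "k < K" for k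
    using K[OF that] \<open>\<epsilon> > 0\<close> by (auto simp: \<rho>_def)
  have s_le: "real (s k) \<le> real n / 2 ^ k" for k
  proof -
    have "2 ^ k * s k = 2 ^ (k + 2 * m) * (n div 2 ^ (k + 2 * m))"
      by (simp add: s_def power_add)
    also have "\<dots> \<le> n" by simp
    finally have "real (2 ^ k * s k) \<le> real n" by (rule of_nat_mono)
    then show ?thesis by (simp add: pos_le_divide_eq mult.commute)
  qed
  have s_le_n: "s k \<le> n" for k
  proof -
    have "real n / 2 ^ k \<le> real n" 
      using mult_left_mono[of 1 "2 ^ k" "real n"] by (simp add: pos_divide_le_eq)
    with s_le[of k] show ?thesis by linarith
  qed
  have s_gt: "real n < 2 * 2 ^ k * real (s k)" if "k < K" for k
  proof -
    define d :: nat where "d = 2 ^ (k + 2 * m)"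
    have "d \<le> 2 ^ (K + 2 * m)"
      unfolding d_def using that by (intro power_increasing) auto
    then have "d \<le> n" using n by simp
    \<comment> \<open>The quotient is at least \<open>1\<close>, so the remainder, being below
      \<open>d\<close>, is smaller than \<open>d * (n div d)\<close>. Rounding therefore loses less
      than a factor of \<open>2\<close>.\<close>
    then have "d * 1 \<le> d * (n div d)"
      by (intro mult_le_mono2) (simp add: d_def Suc_leI div_greater_zero_iff)
    moreover have "n < d * (n div d) + d"
    proof -
      have "n mod d < d" by (simp add: d_def)
      then show ?thesis using mult_div_mod_eq[of d n] by linarith
    qed
    ultimately have "n < 2 * (d * (n div d))" by linarith
    also have "\<dots> = 2 * 2 ^ k * s k" by (simp add: d_def s_def power_add)
    finally have "real n < real (2 * 2 ^ k * s k)" by (simp only: of_nat_less_iff)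
    then show ?thesis by simp
  qed
  have far: "far_from n \<epsilon> (hard k \<pi>) (small_support n m)" if "k < K" "\<pi> \<in> ?P" for k \<pi>
    unfolding hard_def
  proof (rule far_from_hard[OF _ _ s_le_n \<open>m \<ge> 2\<close>])
    show "\<pi> permutes {..<n}" using that by simp
    show "s k = 2 ^ (2 * m) * (n div 2 ^ (k + 2 * m))" by (simp add: s_def)
    have "0 \<le> 2 ^ k * real (s k)" by simp
    then have "8 * real n < 32 * (2 ^ k * real (s k))"
      using s_gt[OF that(1)] unfolding mult.assoc by linarith
    then have "\<epsilon> * (8 * real n) < \<epsilon> * (32 * (2 ^ k * real (s k)))"
      using \<open>\<epsilon> > 0\<close> by (rule mult_strict_left_mono)
    then show "\<epsilon> < \<rho> k * real (s k) / (8 * real n)"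
      using \<open>n > 0\<close> by (simp add: pos_less_divide_eq \<rho>_def mult_ac)
  qed (use \<rho> that \<open>n > 0\<close> in auto)
  have cube: "set_pmf (hard k \<pi>) \<subseteq> cube n" for k \<pi>
    using codeword_in_cube by (auto simp: hard_def)
  have int: "integrable A (\<lambda>a. pmf (run a (hard k \<pi>)) False)" for k \<pi>
    by (intro measure_pmf.integrable_const_bound[where B = 1]) (auto simp: pmf_le_1)
  \<comment> \<open>The rejection probabilities of one fixed plan, summed over all scales and
    permutations, are bounded by its query count with no factor \<open>K\<close>. The constant is
    \<open>128 = 32 * 4\<close>, with \<open>4\<close> from the dyadic sum.\<close>
  have budget: "(\<Sum>k<K. \<Sum>\<pi>\<in>?P. pmf (run a (hard k \<pi>)) False) \<le> fact n * (128 * \<epsilon> * B) / (real m - 1)"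
    if a: "a \<in> set_pmf A" for a
  proof -
    define q where "q i = card (queried a i)" for i
    have "(\<Sum>\<pi>\<in>?P. pmf (run a (hard k \<pi>)) False)
        \<le> \<rho> k * (\<Sum>i<num_samples a. fact n * min 1 ((real (q i) / 2 ^ k)\<^sup>2)) / (real m - 1)"
      if k: "k < K" for k
    proof -
      have "(\<Sum>\<pi>\<in>?P. pmf (run a (hard k \<pi>)) False)
          \<le> (\<Sum>\<pi>\<in>?P. \<rho> k * real (card {i. i < num_samples a \<and> hits a (s k) \<pi> i}) / (real m - 1))"
        unfolding hard_def
        using \<rho>[OF k] by (intro sum_mono prob_reject_le[OF test alg a \<open>m \<ge> 2\<close>]) auto
      also have "\<dots> = \<rho> k * (\<Sum>\<pi>\<in>?P. real (card {i. i < num_samples a \<and> hits a (s k) \<pi> i})) / (real m - 1)"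
        by (simp add: sum_distrib_left sum_divide_distrib)
      also have "\<dots> \<le> \<rho> k * (\<Sum>i<num_samples a. fact n * min 1 ((real (q i) * real (s k) / real n)\<^sup>2)) / (real m - 1)"
        unfolding q_def using \<rho>[OF k] \<open>m \<ge> 2\<close>
        by (intro divide_right_mono mult_left_mono sum_card_hits_le[OF alg a s_le_n]) auto
      also have "\<dots> \<le> \<rho> k * (\<Sum>i<num_samples a. fact n * min 1 ((real (q i) / 2 ^ k)\<^sup>2)) / (real m - 1)"
      proof -
        have "real (q i) * real (s k) / real n \<le> real (q i) / 2 ^ k" for i
        proof -
          have "real (s k) / real n \<le> 1 / 2 ^ k"
            using s_le[of k] \<open>n > 0\<close> by (simp add: field_simps)
          then have "real (q i) * (real (s k) / real n) \<le> real (q i) * (1 / 2 ^ k)"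
            by (rule mult_left_mono) simp
          then show ?thesis by simp
        qed
        then show ?thesis
          using \<rho>[OF k] \<open>m \<ge> 2\<close>
          by (intro divide_right_mono mult_left_mono sum_mono min.mono power_mono) auto
      qed
      finally show ?thesis .
    qed
    then have "(\<Sum>k<K. \<Sum>\<pi>\<in>?P. pmf (run a (hard k \<pi>)) False)
        \<le> (\<Sum>k<K. \<rho> k * (\<Sum>i<num_samples a. fact n * min 1 ((real (q i) / 2 ^ k)\<^sup>2)) / (real m - 1))"
      by (intro sum_mono) auto
    \<comment> \<open>Exchanging the sums leaves one dyadic sum for each sample.\<close>
    also have "\<dots> = (\<Sum>i<num_samples a. fact n * (32 * \<epsilon>) / (real m - 1) *
        (\<Sum>k<K. 2 ^ k * min 1 ((real (q i) / 2 ^ k)\<^sup>2)))"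
      by (subst (2) sum_distrib_left, subst sum.swap)
         (simp add: \<rho>_def sum_distrib_left sum_divide_distrib mult_ac)
    also have "\<dots> \<le> (\<Sum>i<num_samples a. fact n * (32 * \<epsilon>) / (real m - 1) * (4 * real (q i)))"
      using \<open>m \<ge> 2\<close> \<open>\<epsilon> > 0\<close> by (intro sum_mono mult_left_mono sum_dyadic_min_le) auto
    also have "\<dots> = fact n * (128 * \<epsilon>) / (real m - 1) * real (\<Sum>i<num_samples a. q i)"
      unfolding of_nat_sum sum_distrib_left by (intro sum.cong refl) (simp add: mult_ac)
    also have "\<dots> \<le> fact n * (128 * \<epsilon>) / (real m - 1) * B"
    proof (rule mult_left_mono)
      show "real (\<Sum>i<num_samples a. q i) \<le> B"
        using sum_card_queried_le[of a "num_samples a"] B[OF a] unfolding q_def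
        by (meson of_nat_mono order_trans)
    qed (use \<open>m \<ge> 2\<close> \<open>\<epsilon> > 0\<close> in auto)
    finally show ?thesis by (simp add: mult_ac)
  qed
  have cardP: "real (card ?P) = fact n"
    using card_permutations[of "{..<n}" n] by simp
  \<comment> \<open>Each of the \<open>K * n!\<close> choices of scale and permutation gives an
    input rejected with probability above \<open>2 / 3\<close>. Averaging over the coins of
    \<open>A\<close> compares this total with the budget of single plans.\<close>
  have "real K * (fact n * (2 / 3)) = (\<Sum>k<K. \<Sum>\<pi>\<in>?P. 2 / 3)"
    by (simp add: cardP)
  also have "\<dots> \<le> (\<Sum>k<K. \<Sum>\<pi>\<in>?P. pmf (verdict A (hard k \<pi>)) False)"
  proof (intro sum_mono)
    fix k \<pi> assume "k \<in> {..<K}" "\<pi> \<in> ?P"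
    then show "2 / 3 \<le> pmf (verdict A (hard k \<pi>)) False"
      using test far[of k \<pi>] cube[of k \<pi>] by (auto simp: one_sided_test_def intro: less_imp_le)
  qed
  also have "\<dots> = measure_pmf.expectation A (\<lambda>a. \<Sum>k<K. \<Sum>\<pi>\<in>?P. pmf (run a (hard k \<pi>)) False)"
    by (simp add: verdict_eq_run pmf_bind int)
  also have "\<dots> \<le> fact n * (128 * \<epsilon> * B) / (real m - 1)"
    by (intro measure_pmf.integral_le_const Bochner_Integration.integrable_sum int AE_pmfI budget)
  finally have "real K * (fact n * (2 / 3)) * (real m - 1) \<le> fact n * (128 * \<epsilon> * B)"
    using \<open>m \<ge> 2\<close> by (simp add: pos_le_divide_eq)
  then have "fact n * (2 * (real K * (real m - 1))) \<le> fact n * (384 * \<epsilon> * B)"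
    by (simp add: algebra_simps)
  then have "2 * (real K * (real m - 1)) \<le> 384 * \<epsilon> * B"
    by (simp only: mult_le_cancel_left_pos[OF fact_gt_zero])
  then show ?thesis by linarith
qed

lemma exists_scale_count:
  fixes \<epsilon> :: real
  assumes "0 < \<epsilon>" "\<epsilon> < 1 / 2 ^ 12"
  obtains K :: nat where "\<And>k. k < K \<Longrightarrow> 32 * \<epsilon> * 2 ^ k \<le> 1 / 2" "real K \<ge> ln (inverse \<epsilon>) / 2"
proof
  define y where "y = log 2 (inverse \<epsilon>)"
  \<comment> \<open>With \<open>y = log 2 (1 / \<epsilon>)\<close>, the condition
    \<open>32 * \<epsilon> * 2 ^ k <= 1 / 2\<close> says \<open>k <= y - 6\<close>, since
    \<open>64 = 2 ^ 6\<close>.\<close>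
  define K where "K = nat \<lfloor>y - 6\<rfloor>"
  have "2 ^ 12 < inverse \<epsilon>"
    using assms by (simp add: less_divide_eq field_simps)
  then have y: "y > 12"
    unfolding y_def using assms(1) by (subst less_log_iff) auto
  then have K: "real K > y - 7" "real K \<le> y - 6"
    unfolding K_def by linarith+
  have "2 powr y = inverse \<epsilon>"
    using assms by (simp add: y_def)
  show "32 * \<epsilon> * 2 ^ k \<le> 1 / 2" if "k < K" for k
  proof -
    have "(2::real) ^ k = 2 powr real k" by (simp add: powr_realpow)
    also have "\<dots> \<le> 2 powr (y - 6)"
      using K(2) that by (intro powr_mono) auto
    also have "\<dots> = inverse \<epsilon> / 64"
      using \<open>2 powr y = inverse \<epsilon>\<close> by (simp add: powr_diff)
    finally show ?thesis using assms(1) by (simp add: field_simps)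
  qed
  \<comment> \<open>Since \<open>K > y - 7\<close>, it suffices that
    \<open>(25 / 72) * y <= y - 7\<close>, which holds for \<open>y > 12\<close>; this is where
    \<open>\<epsilon> < 1 / 2 ^ 12\<close> enters.\<close>
  have "ln (inverse \<epsilon>) = y * ln 2" by (simp add: y_def log_def)
  also have "\<dots> \<le> y * (25 / 36)"
    using y ln2_le_25_over_36 by (intro mult_left_mono) auto
  finally show "real K \<ge> ln (inverse \<epsilon>) / 2" using K(1) y by linarith
qed

theorem theorem5p6:
  "\<exists>c > (0::real). \<exists>\<epsilon>\<^sub>0 > (0::real). \<forall>m::nat. \<forall>\<epsilon>::real.
     m \<ge> 2 \<longrightarrow> 0 < \<epsilon> \<longrightarrow> \<epsilon> < \<epsilon>\<^sub>0 \<longrightarrow>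
     (\<exists>N::nat. \<forall>n \<ge> N. \<forall>A::plan pmf.
        nonadaptive_alg n A \<longrightarrow> one_sided_test n m \<epsilon> A \<longrightarrow>
        query_complexity A \<ge> ereal (c * inverse \<epsilon> * real m * ln (inverse \<epsilon>)))"
proof -
  have "\<exists>N. \<forall>n\<ge>N. \<forall>A. nonadaptive_alg n A \<longrightarrow> one_sided_test n m \<epsilon> A \<longrightarrow>
      ereal (1 / 1000 * inverse \<epsilon> * real m * ln (inverse \<epsilon>)) \<le> query_complexity A"
    if m: "m \<ge> 2" and \<epsilon>: "0 < \<epsilon>" "\<epsilon> < 1 / 2 ^ 12" for m \<epsilon>
  proof -
    obtain K :: nat where K: "\<And>k. k < K \<Longrightarrow> 32 * \<epsilon> * 2 ^ k \<le> 1 / 2" "real K \<ge> ln (inverse \<epsilon>) / 2"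
      using exists_scale_count[OF \<epsilon>] by blast
    define B where "B = 1 / 1000 * inverse \<epsilon> * real m * ln (inverse \<epsilon>)"
    have "1 < inverse \<epsilon>" using \<epsilon> by (simp add: one_less_inverse_iff)
    then have ln: "ln (inverse \<epsilon>) > 0" by (rule ln_gt_zero)
    have "ereal B \<le> query_complexity A"
      if n: "2 ^ (K + 2 * m) \<le> n" and alg: "nonadaptive_alg n A" and test: "one_sided_test n m \<epsilon> A"
      for n A
    proof (rule ccontr)
      assume "\<not> ereal B \<le> query_complexity A"
      then have less: "query_complexity A < ereal B" by simp
      have len: "real (length (queries a)) \<le> B" if "a \<in> set_pmf A" for a
      proof -
        have "ereal (real (length (queries a))) \<le> query_complexity A"
          unfolding query_complexity_def using that by (rule SUP_upper)
        then have "ereal (real (length (queries a))) < ereal B" using less by (rule le_less_trans)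
        then show ?thesis by simp
      qed
      \<comment> \<open>Here \<open>m >= 2\<close> gives \<open>m - 1 >= m / 2\<close>. The left
        side is \<open>1 / 4\<close> of \<open>m * ln (1 / \<epsilon>)\<close>, while the constant
        \<open>1 / 1000\<close> makes the right side only \<open>192 / 1000\<close> of it.\<close>
      have "(ln (inverse \<epsilon>) / 2) * (real m / 2) \<le> real K * (real m - 1)"
        using K(2) ln m by (intro mult_mono) auto
      also have "\<dots> \<le> 192 * \<epsilon> * B"
        by (rule queries_ge_of_scales[OF test alg m \<epsilon>(1) K(1) n len])
      also have "\<dots> = 192 / 1000 * (real m * ln (inverse \<epsilon>))"
        using \<epsilon> by (simp add: B_def)
      finally have "real m * ln (inverse \<epsilon>) \<le> 0" by (simp add: mult.commute)
      moreover have "real m * ln (inverse \<epsilon>) > 0" using ln m by simp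
      ultimately show False by linarith
    qed
    then show ?thesis unfolding B_def by blast
  qed
  moreover have "(0::real) < 1 / 1000" "(0::real) < 1 / 2 ^ 12" by simp_all
  ultimately show ?thesis by blast
qed

end
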